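(* For every graph $G$ and every positive integer $k$, there exists a $(\leq 3\cdot 4^{\lceil |E(G)|/k\rceil})$-subdivision $S$ of $G$ with $\phi(S)\le 2+12k$.
   Context: An anagram is a word of the form $WP$ where $W$ is a non-empty word and $P$ is a permutation of $W$. A vertex colouring of a graph is anagram-free if the sequence of colours along every path of the graph is not an anagram. $\phi(G)$ is the minimum number of colours in an anagram-free colouring of $G$. A subdivision of $G$ is obtained by replacing each edge $uv$ by a path with endpoints $u,v$; internal vertices are division vertices. A $(\le m)$-subdivision is a subdivision in which every edge receives at most $m$ division vertices. *)

theory Defs
  imports
    Complex_Main
    "HOL-Library.Multiset"
    "Graph_Theory.Pair_Digraph"
    "Graph_Theory.Vertex_Walk"
begin

text \<open>
  Finite simple graphs are \<^locale>\<open>pair_graph\<close>s, so an edge $uv$ is represented by the two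
  arcs $(u,v)$ and $(v,u)$; \<open>edges\<close> identifies these again.
\<close>

definition edges :: "'a pair_pre_digraph \<Rightarrow> 'a set set" where
  "edges G = (\<lambda>(u, v). {u, v}) ` parcs G"

definition anagram :: "'c list \<Rightarrow> bool" where
  "anagram w \<longleftrightarrow> (\<exists>W P. w = W @ P \<and> W \<noteq> [] \<and> mset P = mset W)"

definition anagram_free_colouring :: "'a pair_pre_digraph \<Rightarrow> ('a \<Rightarrow> 'c) \<Rightarrow> bool" where
  "anagram_free_colouring G c \<longleftrightarrow> (\<forall>p. vpath p (with_proj G) \<longrightarrow> \<not> anagram (map c p))"

text \<open>
  Meaningful for finite graphs only (\<^const>\<open>card\<close> is 0 on infinite sets); the minimum is then
  attained, see \<open>phi_attained\<close> below.
\<close>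

definition phi :: "'a pair_pre_digraph \<Rightarrow> nat" where
  "phi G = (LEAST n. \<exists>c :: 'a \<Rightarrow> nat. anagram_free_colouring G c \<and> card (c ` pverts G) = n)"

text \<open>
  \<open>S\<close> is the subdivision of \<open>G\<close> in which each vertex \<open>v\<close> of \<open>G\<close> becomes \<open>f v\<close>, and each edge
  $uv$ is replaced by the path with vertex sequence \<open>f u # D (u, v) @ [f v]\<close>. Thus \<open>D (u, v)\<close>
  lists the division vertices of $uv$ in the order from \<open>u\<close> to \<open>v\<close>, and \<open>D (v, u)\<close> lists the
  same vertices from \<open>v\<close> to \<open>u\<close>. The embedding \<open>f\<close> is needed because the vertex type of \<open>G\<close>
  need not have room for the division vertices.
\<close>

definition subdivision_via ::
  "('a \<Rightarrow> 'b) \<Rightarrow> ('a \<times> 'a \<Rightarrow> 'b list) \<Rightarrow> 'a pair_pre_digraph \<Rightarrow> 'b pair_pre_digraph \<Rightarrow> bool" where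
  "subdivision_via f D G S \<longleftrightarrow>
     inj_on f (pverts G) \<and>
     (\<forall>(u, v) \<in> parcs G. D (v, u) = rev (D (u, v)) \<and> distinct (D (u, v)) \<and>
        set (D (u, v)) \<inter> f ` pverts G = {}) \<and>
     (\<forall>(u, v) \<in> parcs G. \<forall>(x, y) \<in> parcs G.
        {u, v} \<noteq> {x, y} \<longrightarrow> set (D (u, v)) \<inter> set (D (x, y)) = {}) \<and>
     pverts S = f ` pverts G \<union> (\<Union>e \<in> parcs G. set (D e)) \<and>
     parcs S = (\<Union>(u, v) \<in> parcs G. set (vwalk_arcs (f u # D (u, v) @ [f v])))"

definition subdivision_le :: "nat \<Rightarrow> 'a pair_pre_digraph \<Rightarrow> 'b pair_pre_digraph \<Rightarrow> bool" where
  "subdivision_le m G S \<longleftrightarrow>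
     (\<exists>f D. subdivision_via f D G S \<and> (\<forall>e \<in> parcs G. length (D e) \<le> m))"

lemma anagram_free_colouring_inj:
  assumes "inj_on c (pverts G)"
  shows "anagram_free_colouring G c"
  unfolding anagram_free_colouring_def
proof (intro allI impI notI)
  fix p assume p: "vpath p (with_proj G)" and "anagram (map c p)"
  then obtain W P where WP: "map c p = W @ P" "W \<noteq> []" "mset P = mset W"
    by (auto simp: anagram_def)
  have "set p \<subseteq> pverts G" and "distinct p"
    using p by (auto simp: vpath_def vwalk_def)
  then have "distinct (map c p)"
    using assms by (auto simp: distinct_map intro: inj_on_subset)
  with WP(1) have "set W \<inter> set P = {}" by simp
  moreover have "set P = set W" using WP(3) by (rule mset_eq_setD)
  ultimately show False using WP(2) by simp
qed

lemma phi_attained: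
  assumes "finite (pverts G)"
  shows "\<exists>c :: 'a \<Rightarrow> nat. anagram_free_colouring (G :: 'a pair_pre_digraph) c
           \<and> card (c ` pverts G) = phi G"
proof -
  obtain c :: "'a \<Rightarrow> nat" where "inj_on c (pverts G)"
    using finite_imp_inj_to_nat_seg[OF assms] by blast
  then have "\<exists>n. \<exists>c :: 'a \<Rightarrow> nat. anagram_free_colouring G c \<and> card (c ` pverts G) = n"
    using anagram_free_colouring_inj by blast
  then show ?thesis unfolding phi_def by (rule LeastI_ex)
qed

lemma set_vwalk_arcs_rev: "set (vwalk_arcs (rev p)) = prod.swap ` set (vwalk_arcs p)"
proof (induction p)
  case (Cons x p)
  then show ?case
  proof (cases p)
    case (Cons y q)
    have "set (vwalk_arcs (r @ [a, b])) = insert (a, b) (set (vwalk_arcs (r @ [a])))"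
      for r and a b :: 'a
      by (induction r rule: vwalk_arcs.induct) auto
    with Cons.IH Cons show ?thesis by simp
  qed simp
qed simp

lemma vwalk_arcs_distinct:
  "distinct p \<Longrightarrow> (x, y) \<in> set (vwalk_arcs p) \<Longrightarrow> x \<in> set p \<and> y \<in> set p \<and> x \<noteq> y"
  by (induction p rule: vwalk_arcs.induct) auto

lemma pair_graph_subdivision_via:
  assumes G: "pair_graph G" and S: "subdivision_via f D G S"
  shows "pair_graph S"
proof -
  interpret G: pair_graph G by (fact G)
  note S' = S[unfolded subdivision_via_def]
  have D: "D (v, u) = rev (D (u, v))" "distinct (D (u, v))" "set (D (u, v)) \<inter> f ` pverts G = {}"
    if "(u, v) \<in> parcs G" for u v
    using bspec[OF S'[THEN conjunct2, THEN conjunct1] that] by simp_all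
  have verts: "pverts S = f ` pverts G \<union> (\<Union>e \<in> parcs G. set (D e))"
    and arcs: "parcs S = (\<Union>(u, v) \<in> parcs G. set (vwalk_arcs (f u # D (u, v) @ [f v])))"
    and inj: "inj_on f (pverts G)"
    using S' by simp_all
  have path: "distinct (f u # D (u, v) @ [f v])" "set (f u # D (u, v) @ [f v]) \<subseteq> pverts S"
    if "(u, v) \<in> parcs G" for u v
  proof -
    have uv: "u \<in> pverts G" "v \<in> pverts G" "u \<noteq> v"
      using that G.in_arcsD1 G.in_arcsD2 G.pair_no_loops by fastforce+
    then have "f u \<noteq> f v" using inj by (auto dest: inj_onD)
    then show "distinct (f u # D (u, v) @ [f v])" using uv D[OF that] by auto
    show "set (f u # D (u, v) @ [f v]) \<subseteq> pverts S"
      using that uv unfolding verts by auto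
  qed
  have arc: "x \<in> pverts S \<and> y \<in> pverts S \<and> x \<noteq> y" if xy: "(x, y) \<in> parcs S" for x y
  proof -
    from xy obtain u v where uv: "(u, v) \<in> parcs G"
      "(x, y) \<in> set (vwalk_arcs (f u # D (u, v) @ [f v]))" unfolding arcs by blast
    from vwalk_arcs_distinct[OF path(1)[OF uv(1)] uv(2)] path(2)[OF uv(1)] show ?thesis by blast
  qed
  have sym: "(y, x) \<in> parcs S" if xy: "(x, y) \<in> parcs S" for x y
  proof -
    from xy obtain u v where uv: "(u, v) \<in> parcs G"
      "(x, y) \<in> set (vwalk_arcs (f u # D (u, v) @ [f v]))" unfolding arcs by blast
    have "sym (parcs G)"
      using G.pair_sym_arcs by (simp add: symmetric_def)
    then have "(v, u) \<in> parcs G" using uv(1) by (rule symD)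
    moreover have "f v # D (v, u) @ [f u] = rev (f u # D (u, v) @ [f v])"
      using D(1)[OF uv(1)] by simp
    then have "(y, x) \<in> set (vwalk_arcs (f v # D (v, u) @ [f u]))"
      using uv(2) by (metis set_vwalk_arcs_rev image_eqI swap_simp)
    ultimately show ?thesis unfolding arcs by blast
  qed
  have "finite (pverts S)" "finite (parcs S)"
    unfolding verts arcs using G.pair_finite_verts G.pair_finite_arcs by auto
  with arc sym show ?thesis
    by unfold_locales (auto simp: symmetric_def intro: symI)
qed

end

theory Submission
  imports Defs "HOL-Number_Theory.Cong" "HOL-Library.Nat_Bijection"
begin

text \<open>
  Number the edges \<open>0, \<dots>, m - 1\<close>, give edge \<open>y\<close> the level \<open>y div k\<close> and the class \<open>y mod k\<close>, and
  place \<open>8 * 2 ^ l\<close> division vertices on an edge of level \<open>l\<close>. Every second division vertex is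
  coloured by an abelian square-free word over eight letters, the same word for all edges. The other
  ones form four blocks of \<open>2 ^ l\<close> vertices, each block having its own colour in each class. All
  original vertices share one further colour.

  Suppose a path carries an anagram. By its colour, the number of original vertices on the path is
  even. If there are none, the path stays inside an edge and the abelian square-free word is violated.
  Otherwise there are at least two, so the path meets blocks of all four kinds. The two ends of the
  path and its midpoint lie in blocks of at most three kinds, so for the fourth kind \<open>X\<close> each block is
  either disjoint from a half of the path or contained in it. For a class of which a block of kind
  \<open>X\<close> is met, the two halves would represent the same number as sums of powers of two, indexed by
  disjoint sets of levels that are not both empty.
\<close>

section \<open>Abelian square-free words\<close>

definition abelian_square_free :: "'a list \<Rightarrow> bool" where
  "abelian_square_free w \<longleftrightarrow> (\<forall>u v x. w = u @ v @ x \<longrightarrow> \<not> anagram v)"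

text \<open>An abelian square is described by its two ends and its midpoint, and contents of factors
  are differences of contents of prefixes. The equation is kept additive, so that no multisets are
  subtracted.\<close>

lemma abelian_square_free_iff_cuts:
  "abelian_square_free w \<longleftrightarrow>
    (\<forall>i j l. i < j \<longrightarrow> j < l \<longrightarrow> l \<le> length w \<longrightarrow>
       mset (take i w) + mset (take l w) \<noteq> mset (take j w) + mset (take j w))"
    (is "_ \<longleftrightarrow> ?cuts")
proof
  assume free: "abelian_square_free w"
  show ?cuts
  proof (intro allI impI notI)
    fix i j l
    assume ijl: "i < j" "j < l" "l \<le> length w"
      and eq: "mset (take i w) + mset (take l w) = mset (take j w) + mset (take j w)"
    define W P where "W = drop i (take j w)" and "P = drop j (take l w)"
    have j: "take j w = take i w @ W"
      unfolding W_def using ijl by (metis append_take_drop_id min.strict_order_iff take_take)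
    have l: "take l w = take j w @ P"
      unfolding P_def using ijl by (metis append_take_drop_id min.strict_order_iff take_take)
    have "w = take i w @ (W @ P) @ drop l w"
      using j l by (metis append.assoc append_take_drop_id)
    moreover have "mset P = mset W" using eq unfolding l unfolding j by simp
    moreover have "W \<noteq> []" using ijl unfolding W_def by simp
    ultimately show False
      using free unfolding abelian_square_free_def anagram_def by metis
  qed
next
  assume cuts: ?cuts
  show "abelian_square_free w"
    unfolding abelian_square_free_def anagram_def
  proof (intro allI impI notI, elim exE conjE)
    fix u v x W P
    assume w: "w = u @ v @ x" and v: "v = W @ P" "W \<noteq> []" "mset P = mset W"
    have "length u < length u + length W" "length u + length W < length u + length W + length P"
      "length u + length W + length P \<le> length w"
      using w v by (auto dest: mset_eq_length)
    moreover have "mset (take (length u) w) + mset (take (length u + length W + length P) w) =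
        mset (take (length u + length W) w) + mset (take (length u + length W) w)"
      using w v by simp
    ultimately show False using cuts by blast
  qed
qed

lemma mset_concat_map: "mset (concat (map g w)) = (\<Sum>x\<in>#mset w. mset (g x))"
  by (induction w) auto

text \<open>
  Dekking's method. The \<open>h\<close>-weights modulo \<open>n\<close> of the three cuts of an abelian square form an
  arithmetic progression, and as images of letters have weight \<open>0\<close> they only depend on the
  positions of the cuts in the images that contain them. The hypothesis on progressions forces
  these positions to agree, so that the cuts can be moved, all to the left or all to the right,
  to boundaries between images.
\<close>

lemma uniform_morphism_abelian_square_free:
  fixes g :: "'a \<Rightarrow> 'b list" and h :: "'b \<Rightarrow> int"
  assumes len: "\<And>a. a \<in> A \<Longrightarrow> length (g a) = L" and "L > 0"
    and closed: "\<And>a. a \<in> A \<Longrightarrow> [sum_list (map h (g a)) = 0] (mod n)"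
    and prog: "\<And>a b c r s t. \<lbrakk>a \<in> A; b \<in> A; c \<in> A; r < L; s < L; t < L;
        [sum_list (map h (take r (g a))) + sum_list (map h (take t (g c)))
          = 2 * sum_list (map h (take s (g b)))] (mod n)\<rbrakk> \<Longrightarrow>
        r = s \<and> t = s \<and>
        (take s (g a) = take s (g b) \<and> take s (g c) = take s (g b) \<or>
         drop s (g a) = drop s (g b) \<and> drop s (g c) = drop s (g b))"
    and inj: "\<And>X Y. \<lbrakk>set_mset X \<subseteq> A; set_mset Y \<subseteq> A;
        (\<Sum>x\<in>#X. mset (g x)) = (\<Sum>x\<in>#Y. mset (g x))\<rbrakk> \<Longrightarrow> X = Y"
    and w: "abelian_square_free w" "set w \<subseteq> A"
  shows "abelian_square_free (concat (map g w))"
  unfolding abelian_square_free_iff_cuts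
proof (intro allI impI notI)
  let ?G = "\<lambda>w. concat (map g w)" and ?H = "\<lambda>u. sum_list (map h u)"
  fix i j l
  assume ijl: "i < j" "j < l" "l \<le> length (?G w)"
    and eq: "mset (take i (?G w)) + mset (take l (?G w)) = mset (take j (?G w)) + mset (take j (?G w))"
  have length_G: "length (?G u) = L * length u" if "set u \<subseteq> A" for u
    using that by (induction u) (auto simp: len)
  have "w \<noteq> []" using ijl by auto
  have H_G: "[?H (?G u) = 0] (mod n)" if "set u \<subseteq> A" for u
    using that by (induction u) (auto simp: cong_add[OF closed, of _ _ 0, simplified])
  have set_take: "set (take b w) \<subseteq> A" for b using w(2) set_take_subset by fast
  \<comment> \<open>Quotient and remainder by \<open>L\<close> give the image in which a cut lies
    and the offset inside it.\<close>
  have cut: "\<exists>a b r. a \<in> A \<and> r < L \<and> z = L * b + r \<and> b \<le> length w \<and> (r > 0 \<longrightarrow> b < length w \<and> a = w ! b) \<and>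
      take z (?G w) = ?G (take b w) @ take r (g a)"
    if "z \<le> length (?G w)" for z
  proof -
    define b r where "b = z div L" and "r = z mod L"
    have z: "z = L * b + r" "r < L" using \<open>L > 0\<close> by (auto simp: b_def r_def)
    have zw: "z \<le> L * length w" using that length_G[OF w(2)] by simp
    then have b: "b \<le> length w" unfolding b_def using \<open>L > 0\<close>
      by (metis div_le_mono nonzero_mult_div_cancel_left not_gr_zero)
    show ?thesis
    proof (cases "b < length w")
      case True
      have "w = take b w @ w ! b # drop (Suc b) w" using True by (rule id_take_nth_drop)
      then have G: "?G w = ?G (take b w) @ g (w ! b) @ ?G (drop (Suc b) w)"
        by (metis concat.simps(2) concat_append list.simps(9) map_append)
      have "w ! b \<in> A" using True w(2) by auto
      moreover have "length (?G (take b w)) = L * b" using length_G[OF set_take] True by simp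
      then have "take z (?G w) = ?G (take b w) @ take r (g (w ! b))"
        unfolding G z(1) using z(2) len[OF \<open>w ! b \<in> A\<close>] by simp
      ultimately show ?thesis using z True by (intro exI[of _ "w ! b"] exI[of _ b] exI[of _ r]) simp
    next
      case False
      then have "b = length w" using b by simp
      with zw z have "r = 0" by simp
      \<comment> \<open>At the end of \<open>w\<close> no image follows the cut. The offset is
        \<open>0\<close>, and any letter of \<open>A\<close> may stand in.\<close>
      moreover have "hd w \<in> A" using \<open>w \<noteq> []\<close> w(2) by auto
      ultimately show ?thesis using z \<open>b = length w\<close> length_G[OF w(2)]
        by (intro exI[of _ "hd w"] exI[of _ b] exI[of _ 0]) simp
    qed
  qed
  have le: "i \<le> length (?G w)" "j \<le> length (?G w)" using ijl by auto
  obtain a\<^sub>i b\<^sub>i r\<^sub>i where I: "a\<^sub>i \<in> A" "r\<^sub>i < L" "i = L * b\<^sub>i + r\<^sub>i" "b\<^sub>i \<le> length w" "r\<^sub>i > 0 \<longrightarrow> b\<^sub>i < length w \<and> a\<^sub>i = w ! b\<^sub>i"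
    "take i (?G w) = ?G (take b\<^sub>i w) @ take r\<^sub>i (g a\<^sub>i)" using cut[OF le(1)] by blast
  obtain a\<^sub>j b\<^sub>j r\<^sub>j where J: "a\<^sub>j \<in> A" "r\<^sub>j < L" "j = L * b\<^sub>j + r\<^sub>j" "b\<^sub>j \<le> length w" "r\<^sub>j > 0 \<longrightarrow> b\<^sub>j < length w \<and> a\<^sub>j = w ! b\<^sub>j"
    "take j (?G w) = ?G (take b\<^sub>j w) @ take r\<^sub>j (g a\<^sub>j)" using cut[OF le(2)] by blast
  obtain a\<^sub>l b\<^sub>l r\<^sub>l where K: "a\<^sub>l \<in> A" "r\<^sub>l < L" "l = L * b\<^sub>l + r\<^sub>l" "b\<^sub>l \<le> length w" "r\<^sub>l > 0 \<longrightarrow> b\<^sub>l < length w \<and> a\<^sub>l = w ! b\<^sub>l"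
    "take l (?G w) = ?G (take b\<^sub>l w) @ take r\<^sub>l (g a\<^sub>l)" using cut[OF ijl(3)] by blast
  have H_cong: "[?H (?G (take b w) @ u) = ?H u] (mod n)" for b u
    using cong_add[OF H_G[OF set_take, of b] cong_refl[of "?H u" n]] by simp
  have H_mset: "?H u = (\<Sum>x\<in>#mset u. h x)" for u by (metis mset_map sum_mset_sum_list)
  have weights: "?H (take i (?G w)) + ?H (take l (?G w)) = 2 * ?H (take j (?G w))"
    unfolding H_mset using arg_cong[OF eq, of "\<lambda>X. \<Sum>x\<in>#X. h x"] by simp
  have "[?H (take i (?G w)) + ?H (take l (?G w))
      = ?H (take r\<^sub>i (g a\<^sub>i)) + ?H (take r\<^sub>l (g a\<^sub>l))] (mod n)"
    unfolding I(6) K(6) by (intro cong_add H_cong)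
  moreover have "[2 * ?H (take j (?G w)) = 2 * ?H (take r\<^sub>j (g a\<^sub>j))] (mod n)"
    unfolding J(6) by (intro cong_mult H_cong cong_refl)
  ultimately have "[?H (take r\<^sub>i (g a\<^sub>i)) + ?H (take r\<^sub>l (g a\<^sub>l)) = 2 * ?H (take r\<^sub>j (g a\<^sub>j))] (mod n)"
    unfolding weights by (rule cong_trans[OF cong_sym])
  from prog[OF I(1) J(1) K(1) I(2) J(2) K(2) this]
  have r: "r\<^sub>i = r\<^sub>j" "r\<^sub>l = r\<^sub>j"
    and pq: "take r\<^sub>j (g a\<^sub>i) = take r\<^sub>j (g a\<^sub>j) \<and> take r\<^sub>j (g a\<^sub>l) = take r\<^sub>j (g a\<^sub>j) \<or>
      drop r\<^sub>j (g a\<^sub>i) = drop r\<^sub>j (g a\<^sub>j) \<and> drop r\<^sub>j (g a\<^sub>l) = drop r\<^sub>j (g a\<^sub>j)"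
    by blast+
  \<comment> \<open>With equal offsets, the order of the cuts is the order of the images.\<close>
  have b: "b\<^sub>i < b\<^sub>j" "b\<^sub>j < b\<^sub>l" using ijl I(3) J(3) K(3) r \<open>L > 0\<close> by auto
  have no_cuts: False
    if "x < y" "y < z" "z \<le> length w"
      "mset (?G (take x w)) + mset (?G (take z w)) = mset (?G (take y w)) + mset (?G (take y w))"
    for x y z
  proof -
    have "mset (take x w) + mset (take z w) = mset (take y w) + mset (take y w)"
      using that(4) set_take by (intro inj) (auto simp: mset_concat_map dest: in_set_takeD)
    then show False using w(1) that unfolding abelian_square_free_iff_cuts by blast
  qed
  show False
  proof (cases "take r\<^sub>j (g a\<^sub>i) = take r\<^sub>j (g a\<^sub>j) \<and> take r\<^sub>j (g a\<^sub>l) = take r\<^sub>j (g a\<^sub>j)")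
    case True
    then show False using eq b K(4) unfolding I(6) J(6) K(6) r
      by (intro no_cuts[of b\<^sub>i b\<^sub>j b\<^sub>l]) auto
  next
    case False
    \<comment> \<open>At offset \<open>0\<close> all three prefixes would be empty and hence equal.
      So the cuts lie strictly inside images of letters of \<open>w\<close>, and the suffixes
      agree.\<close>
    then have "r\<^sub>j > 0" by (cases r\<^sub>j) auto
    then have lt: "b\<^sub>i < length w" "b\<^sub>j < length w" "b\<^sub>l < length w"
      and a: "a\<^sub>i = w ! b\<^sub>i" "a\<^sub>j = w ! b\<^sub>j" "a\<^sub>l = w ! b\<^sub>l" using I(5) J(5) K(5) r by auto
    have G_Suc: "?G (take (Suc x) w) = (?G (take x w) @ take r\<^sub>j (g (w ! x))) @ drop r\<^sub>j (g (w ! x))"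
      if "x < length w" for x
      using that by (simp add: take_Suc_conv_app_nth)
    show False
      \<comment> \<open>Adding the common suffix twice on each side completes every cut
        image.\<close>
      using False pq lt b arg_cong[OF eq, of "\<lambda>X. X + mset (drop r\<^sub>j (g a\<^sub>j)) + mset (drop r\<^sub>j (g a\<^sub>j))"]
      unfolding I(6) J(6) K(6) r
      by (intro no_cuts[of "Suc b\<^sub>i" "Suc b\<^sub>j" "Suc b\<^sub>l"])
        (auto simp: G_Suc a[symmetric] ac_simps simp del: append_take_drop_id append.assoc)
  qed
qed

section \<open>A substitution on eight letters and its weights modulo 85\<close>

text \<open>
  This substitution was found by a computer search among those commuting with the rotation of the
  letters \<open>0, \<dots>, 3\<close> and \<open>4, \<dots>, 7\<close>, which multiplies weights by \<open>21\<close>, an element of order 4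
  modulo 85.
\<close>

definition sub8 :: "nat \<Rightarrow> nat list" where
  "sub8 a = [[0, 4, 1, 0, 5], [1, 5, 2, 1, 6], [2, 6, 3, 2, 7], [3, 7, 0, 3, 4],
             [0, 4, 5, 3, 4], [1, 5, 6, 0, 5], [2, 6, 7, 1, 6], [3, 7, 4, 2, 7]] ! a"

definition weight8 :: "nat \<Rightarrow> int" where
  "weight8 a = [1, 21, 16, 81, 26, 36, 76, 66] ! a"

text \<open>The residues modulo 85 of the weights of proper prefixes of images, tabulated so that
  later checks compare numerals only.\<close>

definition prefix_weight8 :: "nat \<Rightarrow> nat \<Rightarrow> int" where
  "prefix_weight8 a r =
     [[0, 1, 27, 48, 49], [0, 21, 57, 73, 9], [0, 16, 7, 3, 19], [0, 81, 62, 63, 59],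
      [0, 1, 27, 63, 59], [0, 21, 57, 48, 49], [0, 16, 7, 73, 9], [0, 81, 62, 3, 19]] ! a ! r"

definition prefix_weights8 :: "int set" where
  "prefix_weights8 = {0, 1, 3, 7, 9, 16, 19, 21, 27, 48, 49, 57, 59, 62, 63, 73, 81}"

lemma all_less_8: "(\<forall>a<8. P a) \<longleftrightarrow> P 7 \<and> P 6 \<and> P 5 \<and> P 4 \<and> P 3 \<and> P 2 \<and> P 1 \<and> P (0::nat)"
  by (simp add: numeral_eq_Suc All_less_Suc)

lemma all_less_5: "(\<forall>a<5. P a) \<longleftrightarrow> P 4 \<and> P 3 \<and> P 2 \<and> P 1 \<and> P (0::nat)"
  by (simp add: numeral_eq_Suc All_less_Suc)

lemma sum_less_8: "(\<Sum>a<8. f a) = f 0 + f 1 + f 2 + f 3 + f 4 + f 5 + f 6 + (f (7::nat) :: int)"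
  by (simp add: numeral_eq_Suc)

lemma sub8_props: "\<forall>a<8. length (sub8 a) = 5 \<and> set (sub8 a) \<subseteq> {..<8} \<and>
    sum_list (map weight8 (sub8 a)) mod 85 = 0"
  by (simp add: all_less_8 sub8_def weight8_def)

lemma prefix_weight8: "\<forall>a<8. \<forall>r<5. sum_list (map weight8 (take r (sub8 a))) mod 85 = prefix_weight8 a r"
  by (simp add: all_less_8 all_less_5 sub8_def weight8_def prefix_weight8_def)

lemma prefix_weight8_mem: "\<forall>a<8. \<forall>r<5. prefix_weight8 a r \<in> prefix_weights8"
  by (simp add: all_less_8 all_less_5 prefix_weight8_def prefix_weights8_def)

lemma prefix_weight8_eqD:
  "\<forall>a<8. \<forall>b<8. \<forall>r<5. \<forall>s<5. prefix_weight8 a r = prefix_weight8 b s \<longrightarrow>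
     r = s \<and> (take r (sub8 a) = take r (sub8 b) \<or> drop r (sub8 a) = drop r (sub8 b))"
  by (simp add: all_less_8 all_less_5 sub8_def prefix_weight8_def)

text \<open>Two terms \<open>x\<close>, \<open>y\<close> determine the third,
  \<open>2 * y - x\<close>, so excluding three-term progressions only takes a check over
  pairs.\<close>

lemma prefix_weights8_no_progression:
  "\<forall>x\<in>prefix_weights8. \<forall>y\<in>prefix_weights8. x \<noteq> y \<longrightarrow> (2 * y - x) mod 85 \<notin> prefix_weights8"
  by (simp add: prefix_weights8_def)

lemma prefix_weights8_bounds: "x \<in> prefix_weights8 \<Longrightarrow> x mod 85 = x"
  by (auto simp: prefix_weights8_def)

lemma count_sum_mset:
  assumes "set_mset X \<subseteq> A" "finite A"
  shows "count (\<Sum>x\<in>#X. f x) c = (\<Sum>a\<in>A. count X a * count (f a) c)"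
  using assms(1)
proof (induction X)
  case (add x X)
  then have "(\<Sum>a\<in>A. count (add_mset x X) a * count (f a) c) =
      (\<Sum>a\<in>A. (if a = x then count (f a) c else 0) + count X a * count (f a) c)"
    by (intro sum.cong) auto
  also have "\<dots> = count (f x) c + (\<Sum>a\<in>A. count X a * count (f a) c)"
    using add.prems assms(2) by (simp add: sum.distrib sum.delta)
  finally show ?case using add by simp
qed simp

text \<open>The matrix of letter counts of the eight images is nonsingular, so the content of an
  image word determines the content of its preimage.\<close>

lemma sum_mset_sub8_inj:
  assumes X: "set_mset X \<subseteq> {..<8}" and Y: "set_mset Y \<subseteq> {..<8}"
    and eq: "(\<Sum>x\<in>#X. mset (sub8 x)) = (\<Sum>x\<in>#Y. mset (sub8 x))"
  shows "X = Y"
proof -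
  \<comment> \<open>Differences are taken in the integers, where they solve a homogeneous system of
    eight linear equations.\<close>
  define z where "z a = int (count X a) - int (count Y a)" for a
  have "\<forall>c<8. (\<Sum>a<8. z a * int (count (mset (sub8 a)) c)) = 0"
  proof (intro allI impI)
    fix c :: nat
    have "(\<Sum>a<8. count X a * count (mset (sub8 a)) c) = (\<Sum>a<8. count Y a * count (mset (sub8 a)) c)"
      using arg_cong[OF eq, of "\<lambda>Z. count Z c"] X Y by (simp add: count_sum_mset)
    then have "int (\<Sum>a<8. count X a * count (mset (sub8 a)) c) =
        int (\<Sum>a<8. count Y a * count (mset (sub8 a)) c)" by presburger
    then show "(\<Sum>a<8. z a * int (count (mset (sub8 a)) c)) = 0"
      by (simp add: z_def left_diff_distrib sum_subtractf)
  qed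
  then have "\<forall>a<8. z a = 0"
    unfolding all_less_8 sum_less_8 sub8_def by simp
  then have "count X a = count Y a" if "a < 8" for a using that by (simp add: z_def)
  moreover have "count X a = count Y a" if "\<not> a < 8" for a
    using that X Y by (metis count_inI lessThan_iff subsetD)
  ultimately show ?thesis by (metis multiset_eqI)
qed

lemma abelian_square_free_concat_map_sub8:
  assumes "abelian_square_free w" "set w \<subseteq> {..<8}"
  shows "abelian_square_free (concat (map sub8 w))"
proof (rule uniform_morphism_abelian_square_free[where h = weight8 and n = 85 and A = "{..<8}" and L = 5])
  fix a b c r s t :: nat
  assume abc: "a \<in> {..<8}" "b \<in> {..<8}" "c \<in> {..<8}" "r < 5" "s < 5" "t < 5"
  let ?H = "\<lambda>r a. sum_list (map weight8 (take r (sub8 a)))"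
  assume cong: "[?H r a + ?H t c = 2 * ?H s b] (mod 85)"
  let ?x = "prefix_weight8 a r" and ?y = "prefix_weight8 b s" and ?z = "prefix_weight8 c t"
  have mem: "?x \<in> prefix_weights8" "?y \<in> prefix_weights8" "?z \<in> prefix_weights8"
    using prefix_weight8_mem abc by simp_all
  have "?H r a mod 85 = ?x" "?H s b mod 85 = ?y" "?H t c mod 85 = ?z"
    using prefix_weight8 abc by simp_all
  then have H: "[?H r a = ?x] (mod 85)" "[?H s b = ?y] (mod 85)" "[?H t c = ?z] (mod 85)"
    using prefix_weights8_bounds mem by (simp_all add: cong_def)
  have "[2 * ?H s b - ?H r a = 2 * ?y - ?x] (mod 85)"
    by (rule cong_diff[OF cong_mult[OF cong_refl H(2)] H(1)])
  moreover have "[2 * ?H s b - ?H r a = ?H t c] (mod 85)"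
    using cong_diff[OF cong_sym[OF cong] cong_refl[of "?H r a"]] by simp
  ultimately have "[2 * ?y - ?x = ?z] (mod 85)" using H(3) by (metis cong_sym cong_trans)
  then have z: "(2 * ?y - ?x) mod 85 = ?z" using prefix_weights8_bounds[OF mem(3)] by (simp add: cong_def)
  then have xy: "?x = ?y" using prefix_weights8_no_progression mem by metis
  then have zy: "?z = ?y" using z prefix_weights8_bounds[OF mem(2)] by simp
  have "r = s \<and> (take r (sub8 a) = take r (sub8 b) \<or> drop r (sub8 a) = drop r (sub8 b))"
    "t = s \<and> (take t (sub8 c) = take t (sub8 b) \<or> drop t (sub8 c) = drop t (sub8 b))"
    "r = t \<and> (take r (sub8 a) = take r (sub8 c) \<or> drop r (sub8 a) = drop r (sub8 c))"
    by (rule prefix_weight8_eqD[rule_format]; use abc xy zy in simp)+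
  \<comment> \<open>Each of the three pairs of images shares its prefix or its suffix. Two of the
    pairs do so on the same side, and transitivity covers all three images.\<close>
  then show "r = s \<and> t = s \<and>
      (take s (sub8 a) = take s (sub8 b) \<and> take s (sub8 c) = take s (sub8 b) \<or>
       drop s (sub8 a) = drop s (sub8 b) \<and> drop s (sub8 c) = drop s (sub8 b))"
    by metis
next
  fix X Y :: "nat multiset"
  assume "set_mset X \<subseteq> {..<8}" "set_mset Y \<subseteq> {..<8}"
    "(\<Sum>x\<in>#X. mset (sub8 x)) = (\<Sum>x\<in>#Y. mset (sub8 x))"
  then show "X = Y" by (rule sum_mset_sub8_inj)
qed (use assms sub8_props in \<open>simp_all add: cong_def\<close>)

text \<open>The substitution is iterated from a single letter; each round multiplies the length by
  5.\<close>

lemma abelian_square_free_word_exists: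
  "\<exists>w :: nat list. abelian_square_free w \<and> set w \<subseteq> {..<8} \<and> n < length w"
proof (induction n)
  case 0
  have "abelian_square_free [0::nat]"
    unfolding abelian_square_free_iff_cuts by simp
  then show ?case by (intro exI[of _ "[0]"]) simp
next
  case (Suc n)
  then obtain w :: "nat list" where w: "abelian_square_free w" "set w \<subseteq> {..<8}" "n < length w" by blast
  have "length (concat (map sub8 w)) = 5 * length w"
    using w(2) sub8_props by (induction w) auto
  moreover have "set (concat (map sub8 w)) \<subseteq> {..<8}"
    using w(2) sub8_props by fastforce
  ultimately show ?case
    using abelian_square_free_concat_map_sub8[OF w(1,2)] w(3)
    by (intro exI[of _ "concat (map sub8 w)"]) simp
qed

section \<open>Lists\<close>

text \<open>\<open>Suc a div 2\<close> is half of \<open>a\<close> rounded up, the index of the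
  first even number from \<open>a\<close> on. This locates the letters of \<open>w\<close> on a
  stretch of an edge.\<close>

lemma filter_even_upt: "filter even [a..<b] = map ((*) 2) [Suc a div 2..<Suc b div 2]"
proof (induction b)
  case (Suc b)
  show ?case
  proof (cases "a \<le> b")
    case True
    with Suc show ?thesis by (cases "even b") (auto elim!: evenE oddE)
  qed simp
qed simp

lemma drop_take_conv_map_nth: "j \<le> length w \<Longrightarrow> drop i (take j w) = map ((!) w) [i..<j]"
  by (rule nth_equalityI) auto

text \<open>Reversing direction would revisit the previous number, so a repetition-free walk on the
  integers is monotone.\<close>

lemma distinct_unit_steps:
  assumes "distinct qs" "successively (\<lambda>a b. b = Suc a \<or> a = Suc b) qs"
  shows "\<exists>a. qs = [a..<a + length qs] \<or> rev qs = [a..<a + length qs]"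
  using assms
proof (induction qs)
  case (Cons x qs)
  show ?case
  proof (cases qs)
    case (Cons y ys)
    let ?n = "length qs"
    have step: "y = Suc x \<or> x = Suc y" using Cons.prems Cons by simp
    obtain a where "qs = [a..<a + ?n] \<or> rev qs = [a..<a + ?n]"
      using Cons.IH Cons.prems by (auto simp: successively_Cons)
    then show ?thesis
    proof
      assume up: "qs = [a..<a + ?n]"
      then have "y = a" using Cons by (metis length_greater_0_conv list.discI list.sel(1) hd_upt less_add_same_cancel1)
      show ?thesis
      proof (cases "y = Suc x")
        case True
        then have "[x..<x + length (x # qs)] = x # [a..<a + ?n]"
          using \<open>y = a\<close> by (simp add: upt_conv_Cons del: upt_Suc)
        then show ?thesis using up by metis
      next
        case False
        then have x: "x = Suc a" using step \<open>y = a\<close> by simp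
        have "x \<notin> set qs" using Cons.prems by simp
        \<comment> \<open>A new head that turns back equals the second entry, if there is
          one.\<close>
        then have "?n = 1" using x up Cons
          by (metis One_nat_def Suc_lessI add.commute atLeastLessThan_iff atLeastLessThan_upt
              length_greater_0_conv lessI less_add_same_cancel1 less_imp_le list.discI nat_add_left_cancel_less plus_1_eq_Suc)
        then have "rev (x # qs) = [a..<a + length (x # qs)]"
          using up x by (simp add: upt_rec)
        then show ?thesis by blast
      qed
    next
      assume down: "rev qs = [a..<a + ?n]"
      have "last (rev qs) = y" using Cons by simp
      then have y: "Suc y = a + ?n" unfolding down using Cons by simp
      show ?thesis
      proof (cases "x = Suc y")
        case True
        then have "rev (x # qs) = [a..<a + length (x # qs)]"
          using down y by simp
        then show ?thesis by blast
      next
        case False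
        then have x: "y = Suc x" using step by simp
        have "x \<notin> set (rev qs)" using Cons.prems by simp
        then have "x < a" using down x y by auto
        moreover have "?n > 0" using Cons by simp
        ultimately have "?n = 1" using x y by linarith
        moreover from this have "qs = [y]" using Cons by simp
        ultimately have "x # qs = [x..<x + length (x # qs)]" using x by (simp add: upt_rec)
        then show ?thesis by blast
      qed
    qed
  qed (auto intro: exI[of _ x])
qed simp

lemma count_mset_map_distinct:
  "distinct p \<Longrightarrow> count (mset (map f p)) x = card {z \<in> set p. f z = x}"
proof (induction p)
  case (Cons y p)
  have "{z \<in> set (y # p). f z = x} = (if f y = x then insert y {z \<in> set p. f z = x} else {z \<in> set p. f z = x})"
    by auto
  with Cons show ?case by simp
qed simp

section \<open>The colouring of the subdivision\<close>

text \<open>Only numbered, oriented edges are fixed here; the graph enters later. The even positions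
  of edge \<open>y\<close> number \<open>4 * 2 ^ (y div k)\<close>, which is the length required of
  \<open>w\<close>.\<close>

locale subdivided_edges =
  fixes src tgt :: "nat \<Rightarrow> 'a" and m k :: nat and w :: "nat list"
  assumes k_pos: "k > 0"
    and w_free: "abelian_square_free w" and w_letters: "set w \<subseteq> {..<8}"
    and w_long: "\<And>y. y < m \<Longrightarrow> 4 * 2 ^ (y div k) \<le> length w"
begin

definition len :: "nat \<Rightarrow> nat" where
  "len y = 8 * 2 ^ (y div k)"

text \<open>The vertex type offers only \<open>nat\<close> for division vertices, so edge and
  position are packed into one number.\<close>

definition division :: "nat \<Rightarrow> nat \<Rightarrow> 'a + nat" where
  "division y q = Inr (prod_encode (y, q))"

text \<open>Positions along the whole path of an edge, ends included. They are shifted by one: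
  \<open>division y q\<close> is \<open>node y (Suc q)\<close>.\<close>

definition node :: "nat \<Rightarrow> nat \<Rightarrow> 'a + nat" where
  "node y q = (if q = 0 then Inl (src y) else if q \<le> len y then division y (q - 1) else Inl (tgt y))"

definition adj :: "'a + nat \<Rightarrow> 'a + nat \<Rightarrow> bool" where
  "adj a b \<longleftrightarrow> (\<exists>y<m. \<exists>q\<le>len y. a = node y q \<and> b = node y (Suc q) \<or> b = node y q \<and> a = node y (Suc q))"

text \<open>A superset of the vertices needed: with no graph at hand, all of \<open>'a\<close>
  counts as original.\<close>

definition vertices :: "('a + nat) set" where
  "vertices = range Inl \<union> {division y q | y q. y < m \<and> q < len y}"

text \<open>
  The blocks of an edge have the kinds \<open>0, \<dots>, 3\<close>; original vertices get the spare value \<open>4\<close>.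
\<close>

definition kind :: "'a + nat \<Rightarrow> nat" where
  "kind z = (case z of Inl v \<Rightarrow> 4 | Inr n \<Rightarrow> case prod_decode n of (y, q) \<Rightarrow> q div 2 ^ Suc (y div k))"

text \<open>Colour \<open>0\<close> is for original vertices and \<open>1\<close> to
  \<open>8\<close> for letters of \<open>w\<close>. From \<open>9\<close> on come the markers, with
  the pair of kind and class written as one number in base \<open>k\<close>.\<close>

definition colour :: "'a + nat \<Rightarrow> nat" where
  "colour z = (case z of Inl v \<Rightarrow> 0 | Inr n \<Rightarrow> case prod_decode n of (y, q) \<Rightarrow>
     if even q then Suc (w ! (q div 2)) else 9 + (kind z * k + y mod k))"

lemma division_eq_iff [simp]: "division y q = division y' q' \<longleftrightarrow> y = y' \<and> q = q'"
  by (simp add: division_def)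

lemma division_neq_Inl [simp]: "division y q \<noteq> Inl v" "Inl v \<noteq> division y q"
  by (simp_all add: division_def)

lemma kind_Inl [simp]: "kind (Inl v) = 4"
  by (simp add: kind_def)

lemma kind_division: "kind (division y q) = q div 2 ^ Suc (y div k)"
  by (simp add: kind_def division_def)

lemma colour_Inl [simp]: "colour (Inl v) = 0"
  by (simp add: colour_def)

lemma colour_division_even: "even q \<Longrightarrow> colour (division y q) = Suc (w ! (q div 2))"
  by (simp add: colour_def division_def)

lemma colour_division_odd: "odd q \<Longrightarrow> colour (division y q) = 9 + (kind (division y q) * k + y mod k)"
  by (simp add: colour_def division_def)

lemma kind_less_4_iff: "kind (division y q) < 4 \<longleftrightarrow> q < len y"
  by (simp add: kind_division len_def div_less_iff_less_mult)

lemma vertices_cases: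
  assumes "z \<in> vertices"
  obtains v where "z = Inl v" | y q where "z = division y q" "y < m" "q < len y"
  using assms by (auto simp: vertices_def)

lemma letter_less_8:
  assumes "y < m" "q < len y"
  shows "w ! (q div 2) < 8"
proof -
  have "q div 2 < length w" using w_long[OF assms(1)] assms(2) by (simp add: len_def)
  then show ?thesis using w_letters by (auto dest: nth_mem)
qed

lemma colour_bound:
  assumes "z \<in> vertices"
  shows "colour z < 9 + 4 * k"
  using assms
proof (cases rule: vertices_cases)
  case (2 y q)
  show ?thesis
  proof (cases "even q")
    case True
    then show ?thesis using letter_less_8[OF 2(2,3)] by (simp add: 2(1) colour_division_even)
  next
    case False
    have "kind (division y q) \<le> 3" using 2(3) kind_less_4_iff[of y q] by simp
    then have "kind (division y q) * k \<le> 3 * k" by simp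
    moreover have "y mod k < k" using k_pos by simp
    ultimately have "kind (division y q) * k + y mod k < 4 * k" by linarith
    then show ?thesis using False by (simp add: 2(1) colour_division_odd)
  qed
qed simp

lemma colour_eq_0_iff: "colour z = 0 \<longleftrightarrow> z \<in> range Inl"
  by (cases z) (auto simp: colour_def split: prod.splits)

text \<open>Division with remainder by \<open>k\<close> recovers kind and class, and letters stay
  below colour \<open>9\<close>.\<close>

lemma colour_marker_iff:
  assumes "z \<in> vertices" "j < k"
  shows "colour z = 9 + (X * k + j) \<longleftrightarrow> (\<exists>y q. z = division y q \<and> odd q \<and> y mod k = j \<and> kind z = X)"
  using assms(1)
proof (cases rule: vertices_cases)
  case (2 y q)
  show ?thesis
  proof (cases "even q")
    case True
    then show ?thesis using letter_less_8[OF 2(2,3)] by (simp add: 2(1) colour_division_even)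
  next
    case False
    have "kind z * k + y mod k = X * k + j \<longleftrightarrow> kind z = X \<and> y mod k = j" (is "?l \<longleftrightarrow> _")
    proof
      assume ?l
      from arg_cong[OF this, of "\<lambda>n. n div k"] arg_cong[OF this, of "\<lambda>n. n mod k"]
      show "kind z = X \<and> y mod k = j" using k_pos assms(2) by simp
    qed simp
    then show ?thesis using False by (auto simp: 2(1) colour_division_odd)
  qed
qed auto

lemma node_eq_division_iff: "node y' q' = division y q \<longleftrightarrow> y' = y \<and> q' = Suc q \<and> q < len y"
  by (auto simp: node_def)

lemma node_Suc: "q < len y \<Longrightarrow> node y (Suc q) = division y q"
  by (simp add: node_def)

lemma adj_sym: "adj a b \<Longrightarrow> adj b a"
  by (auto simp: adj_def)

lemma adj_division:
  assumes "adj (division y q) b"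
  shows "y < m \<and> q < len y \<and> (b = node y q \<or> b = node y (Suc (Suc q)))"
  using assms unfolding adj_def by (metis node_eq_division_iff nat.inject)

text \<open>An inner vertex of a path has two distinct neighbours on it, and a division vertex has
  only two possible neighbours.\<close>

lemma neighbours_in_path:
  assumes p: "distinct p" "successively adj p"
    and z: "division y q \<in> set p" "division y q \<noteq> hd p" "division y q \<noteq> last p"
  shows "q < len y \<and> node y q \<in> set p \<and> node y (Suc (Suc q)) \<in> set p"
proof -
  obtain as bs where split: "p = as @ division y q # bs" using z(1) by (meson split_list)
  have ne: "as \<noteq> []" "bs \<noteq> []" using z split by (cases as; cases bs; simp)+
  then obtain as' a b bs' where asbs: "as = as' @ [a]" "bs = b # bs'"
    by (metis append_butlast_last_id list.exhaust)
  have "adj a (division y q)" "adj (division y q) b"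
    using p(2) unfolding split asbs by (simp_all add: successively_append_iff)
  moreover have "a \<noteq> b" using p(1) unfolding split asbs by auto
  ultimately have "{node y q, node y (Suc (Suc q))} \<subseteq> {a, b}" "q < len y"
    using adj_division adj_sym by blast+
  then show ?thesis unfolding split asbs by auto
qed

section \<open>Blocks contained in a path or disjoint from it\<close>

definition uncut :: "nat \<Rightarrow> ('a + nat) set \<Rightarrow> bool" where
  "uncut X A \<longleftrightarrow> (\<forall>y q q'. division y q \<in> A \<longrightarrow> kind (division y q) = X \<longrightarrow> kind (division y q') = X \<longrightarrow>
     division y q' \<in> A)"

text \<open>No vertex of kind \<open>X\<close> is an end of the path, so each one on the path brings
  both neighbours with it, and membership spreads through the block.\<close>

lemma uncut_path:
  assumes p: "distinct p" "successively adj p" and X: "X < 4" "kind (hd p) \<noteq> X" "kind (last p) \<noteq> X"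
  shows "uncut X (set p)"
  unfolding uncut_def
proof (intro allI impI)
  fix y q q'
  let ?k = "\<lambda>q. kind (division y q)"
  assume q: "division y q \<in> set p" "?k q = X" "?k q' = X"
  \<comment> \<open>Kinds increase weakly along an edge, so a block is an interval of
    positions.\<close>
  have between: "?k r = X" if "a \<le> r" "r \<le> b" "?k a = X" "?k b = X" for a r b
    using that div_le_mono unfolding kind_division by (metis order_antisym)
  have nb: "q < len y \<and> node y q \<in> set p \<and> node y (Suc (Suc q)) \<in> set p"
    if "division y q \<in> set p" "?k q = X" for q
    using neighbours_in_path[OF p that(1)] that(2) X by metis
  have up: "division y (Suc r) \<in> set p" if "division y r \<in> set p" "?k r = X" "?k (Suc r) = X" for r
    using nb[OF that(1,2)] that(3) X(1) kind_less_4_iff[of y "Suc r"] node_Suc by metis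
  have down: "division y r \<in> set p" if "division y (Suc r) \<in> set p" "?k (Suc r) = X" for r
    using nb[OF that] node_Suc[of r y] by simp
  show "division y q' \<in> set p"
  proof (cases "q \<le> q'")
    case True
    then have "\<lbrakk>division y q \<in> set p; ?k q = X; ?k q' = X\<rbrakk> \<Longrightarrow> division y q' \<in> set p"
    proof (induction rule: dec_induct)
      case (step r)
      have "?k r = X" using between[of q r "Suc r"] step by simp
      then show ?case using up step by blast
    qed simp
    then show ?thesis using q by blast
  next
    case False
    then have "q' \<le> q" by simp
    then have "\<lbrakk>division y q \<in> set p; ?k q = X; ?k q' = X\<rbrakk> \<Longrightarrow> division y q' \<in> set p"
    proof (induction rule: inc_induct)
      case (step r)
      have "?k (Suc r) = X" using between[of r "Suc r" q] step by simp
      then show ?case using down step by blast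
    qed simp
    then show ?thesis using q by blast
  qed
qed

text \<open>
  When all vertices of kind \<open>X\<close> are removed, every remaining component contains a single original
  vertex, which \<open>side X\<close> selects.
\<close>

definition side :: "nat \<Rightarrow> 'a + nat \<Rightarrow> 'a" where
  "side X z = (case z of Inl v \<Rightarrow> v | Inr n \<Rightarrow> let y = fst (prod_decode n) in if kind z < X then src y else tgt y)"

lemma side_Inl [simp]: "side X (Inl v) = v"
  by (simp add: side_def)

lemma side_division: "side X (division y q) = (if kind (division y q) < X then src y else tgt y)"
  by (simp add: side_def division_def)

text \<open>Kinds run from \<open>0\<close> to \<open>3\<close> along an edge and rise by at most
  one per step, so kind \<open>X\<close> cannot be jumped over.\<close>

lemma adj_side:
  assumes "adj a b" "X < 4" "kind a \<noteq> X" "kind b \<noteq> X"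
  shows "side X a = side X b"
proof -
  have "side X (node y q) = side X (node y (Suc q))"
    if "q \<le> len y" "kind (node y q) \<noteq> X" "kind (node y (Suc q)) \<noteq> X" for y q
  proof -
    have pos: "len y > 0" by (simp add: len_def)
    consider "q = 0" | "q = len y" "q > 0" | r where "q = Suc r" "Suc r < len y"
      using \<open>q \<le> len y\<close> by (cases q) (auto simp: le_less)
    then show ?thesis
    proof cases
      case 1
      then have "node y q = Inl (src y)" "node y (Suc q) = division y 0" using pos by (simp_all add: node_def)
      then show ?thesis using that by (auto simp: side_division kind_division)
    next
      case 2
      then obtain r where r: "q = Suc r" "Suc r = len y" by (cases q) auto
      then have n: "node y q = division y r" "node y (Suc q) = Inl (tgt y)" by (simp_all add: node_def)
      have "kind (division y r) \<ge> 3"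
        using r(2) unfolding kind_division len_def by (simp add: less_eq_div_iff_mult_less_eq)
      then show ?thesis using n that assms(2) by (auto simp: side_division)
    next
      case 3
      then have n: "node y q = division y r" "node y (Suc q) = division y (Suc r)"
        by (simp_all add: node_def)
      have "kind (division y r) \<le> kind (division y (Suc r))" "kind (division y (Suc r)) \<le> Suc (kind (division y r))"
        unfolding kind_division by (auto simp: div_le_mono div_Suc)
      then show ?thesis using n that by (auto simp: side_division)
    qed
  qed
  then show ?thesis using assms unfolding adj_def by metis
qed

text \<open>On a path avoiding kind \<open>X\<close>, \<open>side X\<close> would be constant, yet
  it separates distinct original vertices.\<close>

lemma path_meets_kind:
  assumes "successively adj p" "Inl u \<in> set p" "Inl v \<in> set p" "u \<noteq> v" "X < 4"
  shows "\<exists>z\<in>set p. kind z = X"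
proof (rule ccontr)
  assume no: "\<not> ?thesis"
  have "\<forall>z\<in>set p. side X z = side X (hd p)"
    using assms(1) no
  proof (induction p)
    case (Cons a p)
    then show ?case using adj_side[OF _ assms(5)] by (cases p) (auto simp: successively_Cons)
  qed simp
  then show False using assms(2-4) side_Inl by metis
qed

section \<open>Counting markers in binary, and paths inside one edge\<close>

definition touched :: "nat \<Rightarrow> nat \<Rightarrow> ('a + nat) set \<Rightarrow> nat set" where
  "touched X j A = {y. y mod k = j \<and> (\<exists>q. division y q \<in> A \<and> kind (division y q) = X)}"

lemma finite_touched:
  assumes "finite A"
  shows "finite (touched X j A)"
proof (rule finite_subset)
  show "touched X j A \<subseteq> (\<lambda>z. case z of Inl v \<Rightarrow> 0 | Inr n \<Rightarrow> fst (prod_decode n)) ` A"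
    by (force simp: touched_def division_def image_iff)
qed (use assms in simp)

text \<open>Each touched block lies in \<open>A\<close> entirely and contributes
  \<open>2 ^ (y div k)\<close> markers. Edges of one class have distinct levels, so the total is a
  binary expansion.\<close>

lemma card_marker:
  assumes A: "A \<subseteq> vertices" "finite A" "uncut X A" and j: "j < k"
  shows "card {z \<in> A. colour z = 9 + (X * k + j)} = set_encode ((\<lambda>y. y div k) ` touched X j A)"
proof -
  let ?Y = "touched X j A" and ?L = "\<lambda>y. 2 ^ (y div k) :: nat"
  let ?I = "SIGMA y:?Y. {X * ?L y..<Suc X * ?L y}" and ?f = "\<lambda>(y, r). division y (Suc (2 * r))"
  \<comment> \<open>Markers sit at positions \<open>2 * r + 1\<close>; halving turns block
    \<open>X\<close> into an interval of values of \<open>r\<close>.\<close>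
  have kind_odd: "kind (division y (Suc (2 * r))) = X \<longleftrightarrow> r \<in> {X * ?L y..<Suc X * ?L y}" for y r
  proof -
    have "Suc (2 * r) div 2 ^ Suc (y div k) = r div ?L y" by (simp add: div_mult2_eq)
    moreover have "r div ?L y = X \<longleftrightarrow> X \<le> r div ?L y \<and> r div ?L y < Suc X" by auto
    ultimately show ?thesis
      by (simp add: kind_division less_eq_div_iff_mult_less_eq div_less_iff_less_mult del: mult_Suc)
  qed
  have "{z \<in> A. colour z = 9 + (X * k + j)} = ?f ` ?I"
  proof (intro equalityI subsetI)
    fix z assume z: "z \<in> {z \<in> A. colour z = 9 + (X * k + j)}"
    then obtain y q where yq: "z = division y q" "odd q" "y mod k = j" "kind z = X"
      using A(1) colour_marker_iff[OF _ j] by blast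
    from yq(2) obtain r where "q = Suc (2 * r)" by (auto elim: oddE)
    then show "z \<in> ?f ` ?I"
      using z yq kind_odd by (intro image_eqI[of _ _ "(y, r)"]) (auto simp: touched_def)
  next
    fix z assume "z \<in> ?f ` ?I"
    then obtain y r where yr: "z = division y (Suc (2 * r))" "y \<in> ?Y" "r \<in> {X * ?L y..<Suc X * ?L y}"
      by auto
    then have "kind z = X" using kind_odd by blast
    moreover have "z \<in> A" using A(3) yr \<open>kind z = X\<close> unfolding touched_def uncut_def by blast
    moreover have "y mod k = j" using yr(2) by (simp add: touched_def)
    ultimately show "z \<in> {z \<in> A. colour z = 9 + (X * k + j)}"
      using yr(1) A(1) colour_marker_iff[OF _ j, of z X] by (auto intro!: exI)
  qed
  moreover have "inj_on ?f ?I" by (auto simp: inj_on_def)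
  ultimately have "card {z \<in> A. colour z = 9 + (X * k + j)} = card ?I" by (simp add: card_image)
  also have "\<dots> = (\<Sum>y\<in>?Y. ?L y)" using finite_touched[OF A(2)] by simp
  also have "\<dots> = set_encode ((\<lambda>y. y div k) ` ?Y)"
  proof -
    have "inj_on (\<lambda>y. y div k) ?Y"
      by (rule inj_onI) (metis (mono_tags, lifting) div_mult_mod_eq mem_Collect_eq touched_def)
    then show ?thesis by (simp add: set_encode_def sum.reindex)
  qed
  finally show ?thesis .
qed

text \<open>Discarding the markers leaves consecutive factors of \<open>w\<close>, which would form
  an abelian square.\<close>

lemma edge_not_anagram:
  assumes "y < m" "b \<le> len y" "u @ v = [a..<b]" "u \<noteq> []"
  shows "mset (map (\<lambda>q. colour (division y q)) u) \<noteq> mset (map (\<lambda>q. colour (division y q)) v)"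
    (is "mset (map ?c u) \<noteq> mset (map ?c v)")
proof
  assume eq: "mset (map ?c u) = mset (map ?c v)"
  let ?h = "\<lambda>n. Suc n div 2"
  have lens: "length u = length v" using arg_cong[OF eq, of size] by simp
  define c where "c = a + length u"
  have "length u + length v = b - a" using arg_cong[OF assms(3), of length] by simp
  then have abc: "a < c" "c < b" "b - c = c - a"
    using assms(4) lens by (auto simp: c_def simp flip: length_greater_0_conv)
  have u: "u = [a..<c]" and v: "v = [c..<b]"
    using assms(3) abc take_upt[of a "length u" b] drop_upt[of "length u" a b]
    by (simp_all add: c_def append_eq_conv_conj)
  have filt: "filter (\<lambda>x. x < 9) (map ?c [i..<j]) = map Suc (map ((!) w) [?h i..<?h j])" if "j \<le> len y" for i j
  proof -
    have "?c x < 9 \<longleftrightarrow> even x" if "x < len y" for x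
      using letter_less_8[OF assms(1) that]
      by (cases "even x") (simp_all add: colour_division_even colour_division_odd)
    then have "filter (\<lambda>x. x < 9) (map ?c [i..<j]) = map ?c (filter even [i..<j])"
      using that by (auto simp: filter_map intro!: filter_cong arg_cong[of _ _ "map ?c"])
    then show ?thesis by (simp add: filter_even_upt colour_division_even)
  qed
  have "mset (filter (\<lambda>x. x < 9) (map ?c u)) = mset (filter (\<lambda>x. x < 9) (map ?c v))"
    using eq by (simp only: mset_filter)
  then have "image_mset Suc (mset (map ((!) w) [?h a..<?h c])) = image_mset Suc (mset (map ((!) w) [?h c..<?h b]))"
    using abc assms(2) unfolding u v by (simp only: filt mset_map less_imp_le order_trans)
  from arg_cong[OF this, of "image_mset (\<lambda>n. n - 1)"]
  have P: "mset (map ((!) w) [?h a..<?h c]) = mset (map ((!) w) [?h c..<?h b])"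
    by (simp add: multiset.map_comp o_def)
  have "length [?h a..<?h c] = length [?h c..<?h b]" using mset_eq_length[OF P] by simp
  \<comment> \<open>Both factors have the same length. Were it zero, a stretch of at least two
    positions would contain no even one.\<close>
  then have ne: "[?h a..<?h c] \<noteq> []" using abc by auto
  have le: "?h a \<le> ?h c" "?h c \<le> ?h b" "?h b \<le> length w"
    using abc assms(2) w_long[OF assms(1)] by (auto simp: len_def intro!: div_le_mono)
  have "w = take (?h a) w @ (map ((!) w) [?h a..<?h c] @ map ((!) w) [?h c..<?h b]) @ drop (?h b) w"
  proof -
    have "take j w = take i w @ map ((!) w) [i..<j]" if "i \<le> j" "j \<le> length w" for i j
      using that by (metis append_take_drop_id drop_take_conv_map_nth min_absorb1 take_take)
    from this[OF le(1) order_trans[OF le(2,3)]] this[OF le(2,3)] show ?thesis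
      by (metis append.assoc append_take_drop_id)
  qed
  then show False
    using w_free P ne unfolding abelian_square_free_def anagram_def by (metis map_is_Nil_conv)
qed

text \<open>Neighbours of a division vertex lie on the same edge or are original, so without
  original vertices the edge cannot be left.\<close>

lemma path_in_edge:
  assumes "p \<noteq> []" "successively adj p" "set p \<subseteq> vertices" "set p \<inter> range Inl = {}"
  shows "\<exists>y qs. y < m \<and> p = map (division y) qs \<and> successively (\<lambda>a b. b = Suc a \<or> a = Suc b) qs \<and> (\<forall>q\<in>set qs. q < len y)"
  using assms
proof (induction p rule: list_nonempty_induct)
  case (single z)
  then obtain y q where "z = division y q" "y < m" "q < len y" by (auto elim: vertices_cases)
  then show ?case by (intro exI[of _ y] exI[of _ "[q]"]) simp
next
  case (cons z p)
  then obtain y qs where IH: "y < m" "p = map (division y) qs"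
    "successively (\<lambda>a b. b = Suc a \<or> a = Suc b) qs" "\<forall>q\<in>set qs. q < len y"
    by (auto simp: successively_Cons)
  then obtain r rs where qs: "qs = r # rs" using cons by (cases qs) auto
  obtain y' q where z: "z = division y' q" using cons by (auto elim: vertices_cases)
  have "adj (division y r) z" using cons IH(2) qs by (auto simp: successively_Cons intro: adj_sym)
  from adj_division[OF this] have "y' = y" "q < len y" "r = Suc q \<or> q = Suc r"
    unfolding z by (metis node_eq_division_iff nat.inject)+
  then show ?case using IH qs z by (intro exI[of _ y] exI[of _ "q # qs"]) auto
qed

lemma path_not_anagram:
  assumes p: "distinct p" "successively adj p" "set p \<subseteq> vertices"
  shows "\<not> anagram (map colour p)"
proof
  assume "anagram (map colour p)"
  then obtain W P where WP: "map colour p = W @ P" "W \<noteq> []" "mset P = mset W"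
    unfolding anagram_def by blast
  from WP(1) obtain p1 p2 where split: "p = p1 @ p2" and p12: "W = map colour p1" "P = map colour p2"
    by (auto simp: map_eq_append_conv)
  have "p1 \<noteq> []" and eq: "mset (map colour p1) = mset (map colour p2)" using WP(2,3) p12 by auto
  have dist: "distinct p1" "distinct p2" "set p1 \<inter> set p2 = {}" using p(1) split by auto
  have sub: "set p1 \<subseteq> vertices" "set p2 \<subseteq> vertices" using p(3) split by auto
  have succ: "successively adj p1" using p(2) split by (simp add: successively_append_iff)
  have card_eq: "card {z \<in> set p1. colour z = c} = card {z \<in> set p2. colour z = c}" for c
    using count_mset_map_distinct[OF dist(1), of colour c]
      count_mset_map_distinct[OF dist(2), of colour c] eq by simp
  show False
  proof (cases "set p \<inter> range Inl = {}")
    case True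
    obtain y qs where qs: "y < m" "p = map (division y) qs"
      "successively (\<lambda>a b. b = Suc a \<or> a = Suc b) qs" "\<forall>q\<in>set qs. q < len y"
      using path_in_edge[OF _ p(2,3) True] split \<open>p1 \<noteq> []\<close> by blast
    have "map (division y) qs = p1 @ p2" using qs(2) split by simp
    then obtain qs1 qs2 where qs12: "qs = qs1 @ qs2" "p1 = map (division y) qs1" "p2 = map (division y) qs2"
      by (auto simp: map_eq_append_conv)
    have "qs1 \<noteq> []" "qs2 \<noteq> []" using \<open>p1 \<noteq> []\<close> qs12 eq by auto
    have "distinct qs" using p(1) qs(2) by (simp add: distinct_map)
    from distinct_unit_steps[OF this qs(3)] obtain a
      where a: "qs = [a..<a + length qs] \<or> rev qs = [a..<a + length qs]" by blast
    then have "set qs = {a..<a + length qs}" by (metis set_rev set_upt)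
    moreover have "length qs > 0" using \<open>qs1 \<noteq> []\<close> qs12(1) by simp
    then have "a + length qs - 1 \<in> {a..<a + length qs}"
      unfolding atLeastLessThan_iff by linarith
    ultimately have "a + length qs - 1 \<in> set qs" by simp
    then have b: "a + length qs \<le> len y" using qs(4) by fastforce
    have eq': "mset (map (\<lambda>q. colour (division y q)) qs1) = mset (map (\<lambda>q. colour (division y q)) qs2)"
      using eq qs12 by (simp add: o_def)
    from a show False
    proof
      assume "qs = [a..<a + length qs]"
      then show False using edge_not_anagram[OF qs(1) b, of qs1 qs2] eq' qs12(1) \<open>qs1 \<noteq> []\<close> by simp
    next
      \<comment> \<open>A path running backwards is reversed, which also exchanges its
        halves.\<close>
      assume "rev qs = [a..<a + length qs]"
      then have "rev qs2 @ rev qs1 = [a..<a + length qs]" using qs12(1) by simp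
      from edge_not_anagram[OF qs(1) b this] show False using eq' \<open>qs2 \<noteq> []\<close> by simp
    qed
  next
    case False
    have Inl_iff: "{z \<in> A. colour z = 0} = A \<inter> range Inl" for A
      by (simp add: colour_eq_0_iff Int_def)
    \<comment> \<open>Colour \<open>0\<close> occurs equally often in both halves, so each half
      contains an original vertex.\<close>
    have "card (set p1 \<inter> range Inl) = card (set p2 \<inter> range Inl)"
      using card_eq[of 0] by (simp add: Inl_iff)
    then have "set p1 \<inter> range Inl = {} \<longleftrightarrow> set p2 \<inter> range Inl = {}"
      by (metis card_eq_0_iff finite_Int List.finite_set)
    moreover have "set p \<inter> range Inl = (set p1 \<inter> range Inl) \<union> (set p2 \<inter> range Inl)"
      by (simp add: split Int_Un_distrib2)
    ultimately have "set p1 \<inter> range Inl \<noteq> {}" "set p2 \<inter> range Inl \<noteq> {}"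
      using False by simp_all
    then obtain u v where uv: "Inl u \<in> set p1" "Inl v \<in> set p2" by blast
    then have "u \<noteq> v" using dist by blast
    \<comment> \<open>Three vertices exclude at most three of the four kinds.\<close>
    have "card {kind (hd p), kind (last p), kind (last p1)} < card {..<4::nat}"
      by (simp add: card_insert_if)
    then have "\<not> {..<4} \<subseteq> {kind (hd p), kind (last p), kind (last p1)}"
      by (metis card_mono finite.emptyI finite_insert leD)
    then obtain X where X: "X < 4" "kind (hd p) \<noteq> X" "kind (last p) \<noteq> X" "kind (last p1) \<noteq> X"
      by auto
    have up: "uncut X (set p)" using uncut_path[OF p(1,2)] X by simp
    have up1: "uncut X (set p1)" using uncut_path[OF dist(1) succ] X split \<open>p1 \<noteq> []\<close> by simp
    \<comment> \<open>Blocks of kind \<open>X\<close> are whole in \<open>p\<close> and in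
      \<open>p1\<close>, hence in the remainder \<open>p2\<close>. This is why avoiding three kinds
      suffices.\<close>
    have up2: "uncut X (set p2)"
      unfolding uncut_def
    proof (intro allI impI)
      fix y q q'
      assume q: "division y q \<in> set p2" "kind (division y q) = X" "kind (division y q') = X"
      then have "division y q' \<in> set p" using up split unfolding uncut_def by auto
      moreover have "division y q' \<notin> set p1"
        using up1 q dist(3) unfolding uncut_def by blast
      ultimately show "division y q' \<in> set p2" using split by simp
    qed
    obtain z where z: "z \<in> set p" "kind z = X"
      using path_meets_kind[OF p(2), of u v X] uv \<open>u \<noteq> v\<close> X(1) split by auto
    then obtain y q where yq: "z = division y q" using p(3) X(1) by (auto elim!: vertices_cases)
    define j where "j = y mod k"
    have j: "j < k" using k_pos by (simp add: j_def)
    let ?Y1 = "touched X j (set p1)" and ?Y2 = "touched X j (set p2)"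
    have "set_encode ((\<lambda>y. y div k) ` ?Y1) = set_encode ((\<lambda>y. y div k) ` ?Y2)"
      using card_eq[of "9 + (X * k + j)"] sub up1 up2 j by (simp add: card_marker)
    \<comment> \<open>Binary expansions are unique, so in class \<open>j\<close> both halves touch
      the same levels.\<close>
    then have img: "(\<lambda>y. y div k) ` ?Y1 = (\<lambda>y. y div k) ` ?Y2"
      by (simp add: set_encode_eq finite_touched)
    have same: "y' = y''" if "y' \<in> ?Y1" "y'' \<in> ?Y2" "y' div k = y'' div k" for y' y''
    proof -
      have "y' mod k = y'' mod k" using that(1,2) by (simp add: touched_def)
      then show ?thesis using that(3) by (metis div_mult_mod_eq)
    qed
    have "y \<in> ?Y1 \<or> y \<in> ?Y2" using z yq split by (auto simp: touched_def j_def)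
    then have "y \<in> ?Y1 \<and> y \<in> ?Y2"
    proof
      assume y: "y \<in> ?Y1"
      then have "y div k \<in> (\<lambda>y. y div k) ` ?Y2" unfolding img[symmetric] by (rule imageI)
      then obtain y' where "y' \<in> ?Y2" "y div k = y' div k" by (metis imageE)
      then show ?thesis using same[OF y] y by metis
    next
      assume y: "y \<in> ?Y2"
      then have "y div k \<in> (\<lambda>y. y div k) ` ?Y1" unfolding img by (rule imageI)
      then obtain y' where "y' \<in> ?Y1" "y' div k = y div k" by (metis imageE)
      then show ?thesis using same[of y' y] y by metis
    qed
    \<comment> \<open>Level and class determine the edge, so one block meets both halves, although
      \<open>p1\<close> contains it entirely.\<close>
    then obtain q1 q2 where "division y q1 \<in> set p1" "kind (division y q1) = X"
      "division y q2 \<in> set p2" "kind (division y q2) = X"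
      unfolding touched_def by blast
    then show False using up1 dist(3) unfolding uncut_def by blast
  qed
qed

end

section \<open>The subdivided graph\<close>

lemma set_vwalk_arcs_conv_nth: "set (vwalk_arcs p) = {(p ! i, p ! Suc i) | i. Suc i < length p}"
proof -
  have "vwalk_arcs p = zip p (tl p)" by (induction p rule: vwalk_arcs.induct) auto
  then show ?thesis by (auto simp: set_zip nth_tl)
qed

context subdivided_edges
begin

definition division_path :: "nat \<Rightarrow> ('a + nat) list" where
  "division_path y = map (division y) [0..<len y]"

definition edge_index :: "'a \<Rightarrow> 'a \<Rightarrow> nat" where
  "edge_index u v = (THE y. y < m \<and> {src y, tgt y} = {u, v})"

text \<open>Both arcs of an edge share its index, so the opposite arc reads the same vertices in
  reverse, as a subdivision demands.\<close>

definition arc_path :: "'a \<times> 'a \<Rightarrow> ('a + nat) list" where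
  "arc_path = (\<lambda>(u, v). let y = edge_index u v in
     if u = src y then division_path y else rev (division_path y))"

definition subdivided :: "'a pair_pre_digraph \<Rightarrow> ('a + nat) pair_pre_digraph" where
  "subdivided G = \<lparr>pverts = Inl ` pverts G \<union> (\<Union>e\<in>parcs G. set (arc_path e)),
     parcs = (\<Union>(u, v)\<in>parcs G. set (vwalk_arcs (Inl u # arc_path (u, v) @ [Inl v])))\<rparr>"

lemma adj_arcs:
  assumes "y < m" "(a, b) \<in> set (vwalk_arcs (Inl (src y) # division_path y @ [Inl (tgt y)]))"
  shows "adj a b"
proof -
  let ?p = "Inl (src y) # division_path y @ [Inl (tgt y)]"
  have nth: "?p ! q = node y q" if "q < Suc (Suc (len y))" for q
    using that by (auto simp: division_path_def node_def nth_Cons' nth_append)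
  obtain q where "a = ?p ! q" "b = ?p ! Suc q" "Suc q < length ?p"
    using assms(2) unfolding set_vwalk_arcs_conv_nth by blast
  moreover have "length ?p = Suc (Suc (len y))" by (simp add: division_path_def)
  ultimately have "a = node y q" "b = node y (Suc q)" "q \<le> len y" using nth[of q] nth[of "Suc q"] by (simp_all del: nth_Cons_Suc)
  then show ?thesis using assms(1) unfolding adj_def by blast
qed

section \<open>Subdividing a graph whose edges are numbered without repetition\<close>

context
  fixes G :: "'a pair_pre_digraph"
  assumes G: "pair_graph G"
    and arc: "\<And>y. y < m \<Longrightarrow> (src y, tgt y) \<in> parcs G"
    and indexed: "\<And>u v. (u, v) \<in> parcs G \<Longrightarrow> \<exists>y<m. {src y, tgt y} = {u, v}"
    and index_inj: "\<And>y y'. \<lbrakk>y < m; y' < m; {src y, tgt y} = {src y', tgt y'}\<rbrakk> \<Longrightarrow> y = y'"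
begin

lemma edge_index_eq:
  assumes "y < m" "{src y, tgt y} = {u, v}"
  shows "edge_index u v = y"
  unfolding edge_index_def using assms index_inj by (intro the_equality) auto

lemma src_neq_tgt:
  assumes "y < m"
  shows "src y \<noteq> tgt y"
proof -
  interpret G: pair_graph G by (fact G)
  show ?thesis using assms arc G.pair_no_loops by fastforce
qed

text \<open>Without loops, exactly one of the two arcs of an edge follows its chosen
  orientation.\<close>

lemma arc_path_cases:
  assumes "(u, v) \<in> parcs G"
  obtains y where "y < m" "{src y, tgt y} = {u, v}" "u = src y" "v = tgt y"
      "arc_path (u, v) = division_path y" "arc_path (v, u) = rev (division_path y)"
    | y where "y < m" "{src y, tgt y} = {u, v}" "u = tgt y" "v = src y"
      "arc_path (u, v) = rev (division_path y)" "arc_path (v, u) = division_path y"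
proof -
  obtain y where y: "y < m" "{src y, tgt y} = {u, v}" using indexed[OF assms] by blast
  then have "edge_index u v = y" "edge_index v u = y" by (auto intro: edge_index_eq)
  moreover have "src y \<noteq> tgt y" using src_neq_tgt[OF y(1)] .
  ultimately show thesis
    using that y by (auto simp: arc_path_def doubleton_eq_iff)
qed

lemma subdivision_via_subdivided: "subdivision_via Inl arc_path G (subdivided G)"
  unfolding subdivision_via_def
proof (intro conjI)
  have path: "distinct (division_path y)" "set (division_path y) = {division y q | q. q < len y}" for y
    by (auto simp: division_path_def distinct_map inj_on_def)
  have set_arc_path: "\<exists>y<m. {src y, tgt y} = {u, v} \<and> set (arc_path (u, v)) = {division y q | q. q < len y}"
    if "(u, v) \<in> parcs G" for u v
    using that by (cases rule: arc_path_cases) (auto simp: path)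
  show "\<forall>(u, v)\<in>parcs G. arc_path (v, u) = rev (arc_path (u, v)) \<and> distinct (arc_path (u, v)) \<and>
      set (arc_path (u, v)) \<inter> Inl ` pverts G = {}"
  proof clarify
    fix u v assume uv: "(u, v) \<in> parcs G"
    then show "arc_path (v, u) = rev (arc_path (u, v)) \<and> distinct (arc_path (u, v)) \<and>
      set (arc_path (u, v)) \<inter> Inl ` pverts G = {}"
      by (cases rule: arc_path_cases) (auto simp: path)
  qed
  show "\<forall>(u, v)\<in>parcs G. \<forall>(x, y)\<in>parcs G.
      {u, v} \<noteq> {x, y} \<longrightarrow> set (arc_path (u, v)) \<inter> set (arc_path (x, y)) = {}"
  proof clarify
    fix u v x y assume "(u, v) \<in> parcs G" "(x, y) \<in> parcs G" "{u, v} \<noteq> {x, y}"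
    then show "set (arc_path (u, v)) \<inter> set (arc_path (x, y)) = {}"
      using set_arc_path[of u v] set_arc_path[of x y] by fastforce
  qed
qed (simp_all add: subdivided_def)

lemma pverts_subdivided: "pverts (subdivided G) \<subseteq> vertices"
proof -
  have "set (arc_path (u, v)) \<subseteq> vertices" if "(u, v) \<in> parcs G" for u v
    using that by (cases rule: arc_path_cases) (auto simp: division_path_def vertices_def)
  then have "(\<Union>e\<in>parcs G. set (arc_path e)) \<subseteq> vertices" by auto
  moreover have "Inl ` pverts G \<subseteq> vertices" by (auto simp: vertices_def)
  ultimately show ?thesis by (simp add: subdivided_def)
qed

lemma parcs_subdivided:
  assumes "(a, b) \<in> parcs (subdivided G)"
  shows "adj a b"
proof -
  obtain u v where uv: "(u, v) \<in> parcs G" "(a, b) \<in> set (vwalk_arcs (Inl u # arc_path (u, v) @ [Inl v]))"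
    using assms by (auto simp: subdivided_def)
  from uv(1) show ?thesis
  proof (cases rule: arc_path_cases)
    case (1 y)
    then show ?thesis using uv(2) adj_arcs by simp
  next
    case (2 y)
    then have "Inl u # arc_path (u, v) @ [Inl v] = rev (Inl (src y) # division_path y @ [Inl (tgt y)])"
      by simp
    then have "(b, a) \<in> set (vwalk_arcs (Inl (src y) # division_path y @ [Inl (tgt y)]))"
      using uv(2) by (auto simp: set_vwalk_arcs_rev simp del: rev.simps rev_append)
    then show ?thesis using adj_arcs[OF 2(1)] adj_sym by blast
  qed
qed

lemma anagram_free_subdivided: "anagram_free_colouring (subdivided G) colour"
  unfolding anagram_free_colouring_def
proof (intro allI impI)
  fix p assume "vpath p (with_proj (subdivided G))"
  then have "distinct p" "set p \<subseteq> pverts (subdivided G)" "set (vwalk_arcs p) \<subseteq> parcs (subdivided G)"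
    by (auto simp: vpath_def vwalk_def)
  moreover from this have "successively adj p"
    using parcs_subdivided by (fastforce simp: set_vwalk_arcs_conv_nth successively_conv_nth)
  ultimately show "\<not> anagram (map colour p)"
    using path_not_anagram pverts_subdivided by blast
qed

lemma phi_subdivided: "phi (subdivided G) \<le> 9 + 4 * k"
proof -
  have "phi (subdivided G) \<le> card (colour ` pverts (subdivided G))"
    unfolding phi_def using anagram_free_subdivided by (intro Least_le) blast
  also have "\<dots> \<le> card {..<9 + 4 * k}"
    using colour_bound pverts_subdivided by (intro card_mono) auto
  finally show ?thesis by simp
qed

lemma length_arc_path:
  assumes "e \<in> parcs G"
  shows "\<exists>y<m. length (arc_path e) = len y"
proof -
  obtain u v where e: "e = (u, v)" by (cases e)
  then have "(u, v) \<in> parcs G" using assms by simp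
  then show ?thesis unfolding e by (cases rule: arc_path_cases) (auto simp: division_path_def)
qed

end

end

section \<open>Choice of the numbering and the numerical bounds\<close>

theorem theorem16:
  fixes G :: "'a pair_pre_digraph" and k :: nat
  assumes "pair_graph G" and "k > 0"
  shows "\<exists>S :: ('a + nat) pair_pre_digraph.
           subdivision_le (3 * 4 ^ nat \<lceil>real (card (edges G)) / real k\<rceil>) G S \<and>
           phi S \<le> 2 + 12 * k"
proof -
  interpret G: pair_graph G by (fact assms(1))
  define m where "m = card (edges G)"
  have "finite (edges G)" unfolding edges_def by simp
  then obtain e where e: "bij_betw e {0..<m} (edges G)"
    unfolding m_def using ex_bij_betw_nat_finite by blast
  have "\<forall>y<m. \<exists>u v. (u, v) \<in> parcs G \<and> e y = {u, v}"
    using bij_betwE[OF e] by (force simp: edges_def)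
  then obtain src tgt where st: "\<And>y. y < m \<Longrightarrow> (src y, tgt y) \<in> parcs G \<and> e y = {src y, tgt y}"
    by metis
  \<comment> \<open>No level exceeds \<open>m\<close>, so this length serves all edges.\<close>
  obtain w :: "nat list" where w: "abelian_square_free w" "set w \<subseteq> {..<8}" "4 * 2 ^ m < length w"
    using abelian_square_free_word_exists by blast
  interpret subdivided_edges src tgt m k w
  proof
    fix y assume "y < m"
    then have "(2::nat) ^ (y div k) \<le> 2 ^ m"
      by (intro power_increasing) (auto intro: order_trans[OF div_le_dividend])
    then have "4 * 2 ^ (y div k) \<le> 4 * (2::nat) ^ m" by (rule mult_left_mono) simp
    then show "4 * 2 ^ (y div k) \<le> length w" using w(3) by linarith
  qed (use assms(2) w in auto)
  have indexed: "\<exists>y<m. {src y, tgt y} = {u, v}" if "(u, v) \<in> parcs G" for u v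
  proof -
    have "{u, v} \<in> e ` {0..<m}"
      using that bij_betw_imp_surj_on[OF e] by (auto simp: edges_def)
    then show ?thesis using st by auto
  qed
  have index_inj: "y = y'" if "y < m" "y' < m" "{src y, tgt y} = {src y', tgt y'}" for y y'
  proof -
    have "e y = e y'" using st[OF that(1)] st[OF that(2)] that(3) by simp
    then show ?thesis using inj_onD[OF bij_betw_imp_inj_on[OF e]] that(1,2) by simp
  qed
  note ctxt = assms(1) conjunct1[OF st] indexed index_inj
  define t where "t = nat \<lceil>real m / real k\<rceil>"
  have len_bound: "len y \<le> 3 * 4 ^ t" if "y < m" for y
  proof -
    have "real m / real k \<le> real t" unfolding t_def by linarith
    then have "real m \<le> real (t * k)" using assms(2) by (simp add: field_simps)
    then have "y div k < t" using that assms(2) by (simp add: div_less_iff_less_mult flip: of_nat_mult)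
    \<comment> \<open>An edge exists, so \<open>t\<close> is positive and levels are at most
      \<open>t - 1\<close>. The bound then is
      \<open>8 * 2 ^ s \<le> 12 * 4 ^ s = 3 * 4 ^ Suc s\<close>.\<close>
    then obtain s where s: "t = Suc s" "y div k \<le> s" by (cases t) auto
    then have "len y \<le> 8 * 2 ^ s" unfolding len_def by (simp add: power_increasing)
    also have "\<dots> \<le> 12 * 4 ^ s" by (intro mult_mono power_mono) auto
    finally show ?thesis by (simp add: s)
  qed
  have "\<forall>e\<in>parcs G. length (arc_path e) \<le> 3 * 4 ^ t"
    using length_arc_path[OF ctxt] len_bound by fastforce
  then have "subdivision_le (3 * 4 ^ t) G (subdivided G)"
    unfolding subdivision_le_def using subdivision_via_subdivided[OF ctxt] by (intro exI conjI)
  moreover have "phi (subdivided G) \<le> 2 + 12 * k"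
  proof (rule order_trans[OF phi_subdivided[OF ctxt]])
    \<comment> \<open>This amounts to \<open>7 \<le> 8 * k\<close>, which holds as \<open>k\<close>
      is positive.\<close>
    show "9 + 4 * k \<le> 2 + 12 * k" using assms(2) by linarith
  qed
  ultimately show ?thesis unfolding t_def m_def by (intro exI conjI)
qed

end
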